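(* Any range-minimum data structure in the encoding model for arrays of length $n$ that contain $r$ runs must occupy at least $\lg N_{n,r}\ge 2\lg\binom nr-O(\log n)$ bits of space, where $N_{n,r}=\frac1n\binom nr\binom n{r-1}$ are the Narayana numbers.
   Context: For an array $A[1..n]$, a run is a maximal contiguous index range $[j_i,j_{i+1}-1]$ with $A[j_i]\le A[j_i+1]\le\cdots\le A[j_{i+1}-1]$; $A$ has $r$ runs if it splits into exactly $r$ such ranges. A range-minimum query $\mathrm{RMQ}(i,j)$ returns the index of the (leftmost) minimum of $A[i..j]$. In the encoding model the data structure must answer all such queries without access to $A$; the lower bound is on the number of bits needed to distinguish all such arrays that differ in some query answer. *)

theory Defs
  imports Complex_Main "HOL-Library.Landau_Symbols"
begin

text \<open>
  Arrays are lists, so positions are counted from 0: the entry written A[i] in the usual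
  1-based notation is \<open>A ! (i - 1)\<close>.
\<close>

definition nondecreasing_range :: "'a::linorder list \<Rightarrow> nat \<Rightarrow> nat \<Rightarrow> bool" where
  "nondecreasing_range A a b \<longleftrightarrow>
     a \<le> b \<and> b < length A \<and> (\<forall>k. a \<le> k \<and> k < b \<longrightarrow> A ! k \<le> A ! Suc k)"

text \<open>
  A run is represented by the pair of its first and last position. The runs partition the
  positions of the array, so the array splits into exactly \<open>card (runs A)\<close> of them.
\<close>

definition runs :: "'a::linorder list \<Rightarrow> (nat \<times> nat) set" where
  "runs A = {(a, b). nondecreasing_range A a b \<and>
     (\<forall>a' b'. nondecreasing_range A a' b' \<and> a' \<le> a \<and> b \<le> b' \<longrightarrow> a' = a \<and> b' = b)}"

definition arrays_with_runs :: "nat \<Rightarrow> nat \<Rightarrow> 'a::linorder list set" where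
  "arrays_with_runs n r = {A. length A = n \<and> card (runs A) = r}"

definition rmq :: "'a::linorder list \<Rightarrow> nat \<Rightarrow> nat \<Rightarrow> nat" where
  "rmq A i j = (LEAST k. i \<le> k \<and> k \<le> j \<and> (\<forall>l. i \<le> l \<and> l \<le> j \<longrightarrow> A ! k \<le> A ! l))"

text \<open>
  A data structure in the encoding model occupying \<open>s\<close> bits consists of a preprocessing
  function that maps an array to a memory content of \<open>s\<close> bits, and a query function
  that sees only this memory content and the query range. Both may depend on \<open>n\<close>, \<open>r\<close> and
  \<open>s\<close>, and nothing is required on arrays outside \<open>arrays_with_runs n r\<close>.
\<close>

definition rmq_encoding ::
  "nat \<Rightarrow> nat \<Rightarrow> nat \<Rightarrow> ('a::linorder list \<Rightarrow> bool list) \<Rightarrow> (bool list \<Rightarrow> nat \<Rightarrow> nat \<Rightarrow> nat) \<Rightarrow> bool" where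
  "rmq_encoding n r s preproc query \<longleftrightarrow>
     (\<forall>A \<in> arrays_with_runs n r.
        length (preproc A) = s \<and>
        (\<forall>i j. i \<le> j \<and> j < n \<longrightarrow> query (preproc A) i j = rmq A i j))"

definition narayana :: "nat \<Rightarrow> nat \<Rightarrow> real" where
  "narayana n r = 1 / real n * real (n choose r) * real (n choose (r - 1))"

end

theory Submission
  imports Defs
begin

text \<open>
  Among the arrays with the same answers to all range-minimum queries there is exactly one list of
  naturals that ends in 0 and in which no entry exceeds its right neighbour by more than 1 (the
  entry counts how often one can move from the position to the next strictly smaller entry on its
  right). An array of length \<open>n\<close> with \<open>r\<close> runs has \<open>n - r\<close>
  weak ascents. Prepending an entry to such a list gives a recursion for the number of lists with
  prescribed length, number of weak ascents and lower bound on the first entry; it is solved by a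
  difference of products of binomial coefficients, as produced by the reflection principle.
  Without a bound on the first entry this is the Narayana number.
\<close>

section \<open>Runs and weak ascents\<close>

text \<open>A run is determined by its first position, so runs can be counted by the positions that
  no weak ascent enters from the left.\<close>

definition run_starts :: "'a::linorder list \<Rightarrow> nat set" where
  "run_starts A = {a. a < length A \<and> (a = 0 \<or> A ! a < A ! (a - 1))}"

fun weak_ascents :: "'a::linorder list \<Rightarrow> nat" where
  "weak_ascents (x # y # A) = (if x \<le> y then 1 else 0) + weak_ascents (y # A)"
| "weak_ascents _ = 0"

text \<open>Runs with a common start are nested, so maximality makes them equal.\<close>

lemma inj_on_fst_runs: "inj_on fst (runs A)"
proof -
  have le: "b = b'" if "(a, b) \<in> runs A" "(a, b') \<in> runs A" "b \<le> b'" for a b b'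
  proof -
    have "nondecreasing_range A a b'"
      using that(2) by (simp add: runs_def)
    then show ?thesis
      using that(1,3) by (auto simp: runs_def)
  qed
  have "b = b'" if "(a, b) \<in> runs A" "(a, b') \<in> runs A" for a b b'
    using le[OF that] le[OF that(2,1)] by (cases "b \<le> b'") auto
  then show ?thesis
    unfolding inj_on_def by (metis prod.collapse)
qed

lemma fst_runs: "fst ` runs A = run_starts A"
proof (intro set_eqI iffI)
  fix a assume "a \<in> fst ` runs A"
  then obtain b where b: "nondecreasing_range A a b"
    "\<And>a' b'. nondecreasing_range A a' b' \<Longrightarrow> a' \<le> a \<Longrightarrow> b \<le> b' \<Longrightarrow> a' = a \<and> b' = b"
    by (auto simp: runs_def)
  have "A ! a < A ! (a - 1)" if "a \<noteq> 0"
  proof (rule ccontr)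
    assume "\<not> A ! a < A ! (a - 1)"
    then have "A ! (a - 1) \<le> A ! Suc (a - 1)"
      using that by simp
    moreover have "k = a - 1 \<or> a \<le> k" if "a - 1 \<le> k" for k
      using that by linarith
    ultimately have "nondecreasing_range A (a - 1) b"
      using b(1) unfolding nondecreasing_range_def by (metis diff_le_self le_trans)
    from b(2)[OF this] show False
      using that by simp
  qed
  then show "a \<in> run_starts A"
    using b(1) by (auto simp: run_starts_def nondecreasing_range_def)
next
  fix a assume a: "a \<in> run_starts A"
  \<comment> \<open>The longest nondecreasing range from \<open>a\<close> is a run: the drop before
    \<open>a\<close> blocks any extension to the left.\<close>
  define P where "P b \<longleftrightarrow> nondecreasing_range A a b" for b
  have "P a"
    using a by (auto simp: P_def run_starts_def nondecreasing_range_def)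
  moreover have bound: "\<And>b. P b \<Longrightarrow> b \<le> length A"
    by (auto simp: P_def nondecreasing_range_def)
  ultimately have PG: "P (Greatest P)" and G: "\<And>b. P b \<Longrightarrow> b \<le> Greatest P"
    by (blast intro: GreatestI_nat Greatest_le_nat)+
  have "a' = a \<and> b' = Greatest P"
    if r: "nondecreasing_range A a' b'" "a' \<le> a" "Greatest P \<le> b'" for a' b'
  proof -
    have le: "a \<le> Greatest P"
      using G \<open>P a\<close> by blast
    have "a' = a"
    proof (rule ccontr)
      assume "a' \<noteq> a"
      then have "a' \<le> a - 1" "a - 1 < b'" "Suc (a - 1) = a"
        using r le by auto
      then have "A ! (a - 1) \<le> A ! a"
        using r(1) unfolding nondecreasing_range_def by metis
      then show False
        using a \<open>a' \<noteq> a\<close> r(2) by (auto simp: run_starts_def)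
    qed
    then show ?thesis
      using G[of b'] r by (auto simp: P_def)
  qed
  then have "(a, Greatest P) \<in> runs A"
    using PG by (auto simp: runs_def P_def)
  then show "a \<in> fst ` runs A"
    by force
qed

lemma run_starts_Cons:
  "run_starts (x # y # A) =
    insert 0 (Suc ` (if x \<le> y then run_starts (y # A) - {0} else run_starts (y # A)))"
proof (rule set_eqI)
  fix a
  show "a \<in> run_starts (x # y # A) \<longleftrightarrow> a \<in> insert 0
    (Suc ` (if x \<le> y then run_starts (y # A) - {0} else run_starts (y # A)))"
  proof (cases a)
    case (Suc b)
    have mem: "Suc b \<in> Suc ` S \<longleftrightarrow> b \<in> S" for S
      by (rule inj_image_mem_iff) simp
    show ?thesis
      unfolding Suc insert_iff mem by (cases b) (auto simp: run_starts_def not_less)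
  qed (simp add: run_starts_def)
qed

lemma finite_run_starts: "finite (run_starts A)"
  by (rule finite_subset[of _ "{..<length A}"]) (auto simp: run_starts_def)

text \<open>Each position after the first either starts a run or is the right end of a weak
  ascent.\<close>

lemma card_run_starts: "card (run_starts A) + weak_ascents A = length A"
proof (induction A rule: weak_ascents.induct)
  case (1 x y A)
  have "0 \<in> run_starts (y # A)"
    by (simp add: run_starts_def)
  then have "card (run_starts (y # A) - {0}) + 1 = card (run_starts (y # A))"
    using finite_run_starts by (metis Suc_eq_plus1 card_Suc_Diff1)
  then show ?case
    using 1 by (auto simp: run_starts_Cons card_insert_disjoint card_image finite_run_starts)
next
  case "2_1"
  show ?case by (simp add: run_starts_def)
next
  case ("2_2" v)
  have "run_starts [v] = {0}"
    by (auto simp: run_starts_def)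
  then show ?case by simp
qed

lemma card_runs: "card (runs A) + weak_ascents A = length A"
  by (metis card_image card_run_starts fst_runs inj_on_fst_runs)

text \<open>Carries counts for lists of naturals over to arrays of another element type.\<close>

lemma weak_ascents_map:
  assumes "strict_mono_on S g" "set A \<subseteq> S"
  shows "weak_ascents (map g A) = weak_ascents A"
  using assms(2)
proof (induction A rule: weak_ascents.induct)
  case (1 x y A)
  then show ?case
    using strict_mono_on_less_eq[OF assms(1)] by simp
qed simp_all

section \<open>Range minima\<close>

text \<open>Ties go to the leftmost position, so the left end only has to be weakly minimal. Whether
  a query returns its left end is enough to tell canonical arrays apart.\<close>

lemma rmq_eq_left_iff:
  assumes "i \<le> j"
  shows "rmq A i j = i \<longleftrightarrow> (\<forall>l. i \<le> l \<and> l \<le> j \<longrightarrow> A ! i \<le> A ! l)" (is "_ \<longleftrightarrow> ?R")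
proof
  assume eq: "rmq A i j = i"
  let ?P = "\<lambda>k. i \<le> k \<and> k \<le> j \<and> (\<forall>l. i \<le> l \<and> l \<le> j \<longrightarrow> A ! k \<le> A ! l)"
  have "finite ((!) A ` {i..j})" "(!) A ` {i..j} \<noteq> {}"
    using assms by auto
  then obtain k where "k \<in> {i..j}" "A ! k = Min ((!) A ` {i..j})"
    using Min_in by (metis imageE)
  then have "?P k"
    using Min_le[OF \<open>finite ((!) A ` {i..j})\<close>] by auto
  then have "?P (rmq A i j)"
    unfolding rmq_def by (rule LeastI)
  then show ?R
    using eq by simp
next
  assume ?R
  then show "rmq A i j = i"
    unfolding rmq_def using assms by (intro Least_equality) auto
qed

section \<open>Canonical arrays\<close>

fun canonical :: "nat list \<Rightarrow> bool" where
  "canonical [] \<longleftrightarrow> False"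
| "canonical [x] \<longleftrightarrow> x = 0"
| "canonical (x # y # t) \<longleftrightarrow> x \<le> Suc y \<and> canonical (y # t)"

lemma canonical_nth:
  assumes "canonical t"
  shows "t ! (length t - 1) = 0" "Suc k < length t \<Longrightarrow> t ! k \<le> Suc (t ! Suc k)"
  using assms
proof (induction t arbitrary: k rule: canonical.induct)
  case (3 x y t)
  {
    case 1
    then show ?case using 3 by simp
  next
    case 2
    then show ?case using 3 by (cases k) auto
  }
qed auto

text \<open>Going left from the final 0, entries rise by at most 1 per step.\<close>

lemma canonical_hd_less: "canonical t \<Longrightarrow> hd t < length t"
  by (induction t rule: canonical.induct) auto

lemma canonical_set_less: "canonical t \<Longrightarrow> set t \<subseteq> {..<length t}"
proof (induction t rule: canonical.induct)
  case (3 x y t)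
  then show ?case
    using canonical_hd_less[OF 3(2)] by fastforce
qed auto

text \<open>
  If \<open>j\<close> is the last position at which the lists differ, with the smaller entry in \<open>t\<close>, and
  \<open>i\<close> is the first later position with \<open>t ! i \<le> t ! j\<close>, then slow decrease gives
  \<open>t ! i = t ! j\<close>, and the two lists answer the query from \<open>j\<close> to \<open>i\<close> differently.
\<close>

lemma canonical_last_difference:
  assumes t: "canonical t" and u: "canonical u" and len: "length t = length u"
    and j: "j < length t" "t ! j < u ! j"
    and agree: "\<And>l. j < l \<Longrightarrow> l < length t \<Longrightarrow> t ! l = u ! l"
  obtains i where "j \<le> i" "i < length t"
    "\<forall>l. j \<le> l \<and> l \<le> i \<longrightarrow> t ! j \<le> t ! l" "u ! i < u ! j"
proof -
  have "j \<noteq> length t - 1"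
    using canonical_nth(1)[OF u] j(2) len by auto
  then have sj: "Suc j < length t"
    using j(1) by linarith
  define P where "P i \<longleftrightarrow> j < i \<and> i < length t \<and> t ! i \<le> t ! j" for i
  define i where "i = (LEAST i. P i)"
  have "P (length t - 1)"
    using canonical_nth(1)[OF t] sj by (auto simp: P_def)
  then have i: "P i"
    unfolding i_def by (rule LeastI)
  have before: "t ! j < t ! l" if "j < l" "l < i" for l
  proof -
    have "\<not> P l"
      using that(2) unfolding i_def by (rule not_less_Least)
    then show ?thesis
      using that i by (auto simp: P_def)
  qed
  \<comment> \<open>If \<open>i = Suc j\<close>, slow decrease is applied in \<open>u\<close>, whose
    entry at \<open>j\<close> is larger and whose right neighbour agrees with that of
    \<open>t\<close>. Otherwise it is applied in \<open>t\<close>, where the entry before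
    \<open>i\<close> is still above \<open>t ! j\<close>.\<close>
  have "t ! j \<le> t ! i"
  proof (cases "i = Suc j")
    case True
    then show ?thesis
      using canonical_nth(2)[OF u, of j] sj len agree[of "Suc j"] j(2) by simp
  next
    case False
    then have "j < i - 1" "i - 1 < i" "Suc (i - 1) = i"
      using i by (auto simp: P_def)
    then show ?thesis
      using before[of "i - 1"] canonical_nth(2)[OF t, of "i - 1"] i by (simp add: P_def)
  qed
  then have below: "\<forall>l. j \<le> l \<and> l \<le> i \<longrightarrow> t ! j \<le> t ! l"
    using before by (metis le_neq_implies_less less_imp_le order_refl)
  have "u ! i < u ! j"
    using i agree[of i] j(2) by (auto simp: P_def)
  then show ?thesis
    using that[OF _ _ below] i by (simp add: P_def)
qed

text \<open>At the last difference, some query returns its left end for one array but not for the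
  other. The map \<open>g\<close> places the entries in an arbitrary linear order.\<close>

lemma canonical_eqI_rmq:
  assumes t: "canonical t" and u: "canonical u" and len: "length t = length u"
    and g: "strict_mono_on {..<length t} g"
    and rmq: "\<And>i j. i \<le> j \<Longrightarrow> j < length t \<Longrightarrow> rmq (map g t) i j = rmq (map g u) i j"
  shows "t = u"
proof (rule ccontr)
  assume "t \<noteq> u"
  define D where "D = {j. j < length t \<and> t ! j \<noteq> u ! j}"
  have "finite D" "D \<noteq> {}"
    using \<open>t \<noteq> u\<close> len by (auto simp: D_def list_eq_iff_nth_eq)
  then obtain j where j: "j \<in> D" and above: "\<And>l. l \<in> D \<Longrightarrow> l \<le> j"
    using Max_in Max_ge by blast
  have agree: "t ! l = u ! l" if "j < l" "l < length t" for l
  proof (rule ccontr)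
    assume "t ! l \<noteq> u ! l"
    then have "l \<in> D"
      using that(2) by (simp add: D_def)
    from above[OF this] show False
      using that(1) by simp
  qed
  have g_le: "map g v ! a \<le> map g v ! b \<longleftrightarrow> v ! a \<le> v ! b"
    if "canonical v" "length v = length t" "a < length t" "b < length t" for v a b
  proof -
    have "v ! a \<in> {..<length t}" "v ! b \<in> {..<length t}"
      using canonical_set_less[OF that(1)] that nth_mem subsetD by metis+
    then show ?thesis
      using strict_mono_on_less_eq[OF g] that by simp
  qed
  have rmq_iff: "rmq (map g v) i j = i \<longleftrightarrow> (\<forall>l. i \<le> l \<and> l \<le> j \<longrightarrow> v ! i \<le> v ! l)"
    if "canonical v" "length v = length t" "i \<le> j" "j < length t" for v i j
    using that g_le[OF that(1,2)] by (auto simp: rmq_eq_left_iff)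
  consider "t ! j < u ! j" | "u ! j < t ! j"
    using j by (force simp: D_def)
  then show False
  proof cases
    case 1
    obtain i where "j \<le> i" "i < length t"
      "\<forall>l. j \<le> l \<and> l \<le> i \<longrightarrow> t ! j \<le> t ! l" "u ! i < u ! j"
      using canonical_last_difference[OF t u len _ 1] j agree by (auto simp: D_def)
    then show ?thesis
      using rmq[of j i] rmq_iff[OF t, of j i] rmq_iff[OF u, of j i] len
      by (metis not_le order_refl)
  next
    case 2
    obtain i where "j \<le> i" "i < length t"
      "\<forall>l. j \<le> l \<and> l \<le> i \<longrightarrow> u ! j \<le> u ! l" "t ! i < t ! j"
      using canonical_last_difference[OF u t len[symmetric] _ 2] j agree len
      by (auto simp: D_def)
    then show ?thesis
      using rmq[of j i] rmq_iff[OF t, of j i] rmq_iff[OF u, of j i] len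
      by (metis not_le order_refl)
  qed
qed

section \<open>Counting canonical arrays\<close>

text \<open>Canonical lists are nonempty, hence the length \<open>Suc N\<close>, which makes
  \<open>N\<close> the largest possible first entry. A lower bound \<open>h\<close> instead of an
  exact first entry avoids a sum over second entries in the recursion.\<close>

definition canonicals :: "nat \<Rightarrow> nat \<Rightarrow> nat \<Rightarrow> nat list set" where
  "canonicals N m h =
    {t. length t = Suc N \<and> canonical t \<and> weak_ascents t = m \<and> h \<le> hd t}"

lemma finite_canonicals [simp]: "finite (canonicals N m h)"
  by (rule finite_subset[OF _ finite_lists_length_eq[of "{..<Suc N}" "Suc N"]])
    (use canonical_set_less in \<open>fastforce simp: canonicals_def\<close>)+

lemma canonicals_empty: "N < h \<Longrightarrow> canonicals N m h = {}"
  using canonical_hd_less by (fastforce simp: canonicals_def)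

lemma canonicals_antimono: "canonicals N m (Suc h) \<subseteq> canonicals N m h"
  by (auto simp: canonicals_def)

text \<open>After a first entry \<open>h\<close>, the second entry is either \<open>h - 1\<close>,
  giving no weak ascent and impossible for \<open>h = 0\<close>, or at least \<open>h\<close>,
  giving one.\<close>

lemma canonicals_diff_Suc:
  "canonicals (Suc N) m h - canonicals (Suc N) m (Suc h) =
    (if h = 0 then {} else (#) h ` (canonicals N m (h - 1) - canonicals N m h)) \<union>
    (if m = 0 then {} else (#) h ` canonicals N (m - 1) h)" (is "?L = ?R")
proof (rule set_eqI)
  fix t
  show "t \<in> ?L \<longleftrightarrow> t \<in> ?R"
  proof (cases "\<exists>x y s. t = x # y # s")
    case True
    then obtain x y s where t: "t = x # y # s"
      by blast
    have Cons_image: "x # y # s \<in> (#) h ` S \<longleftrightarrow> x = h \<and> y # s \<in> S" for S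
      by auto
    show ?thesis
    proof (cases "x = h")
      case True
      then show ?thesis
        unfolding t by (cases "h \<le> y"; cases m) (auto simp: Cons_image canonicals_def)
    next
      case False
      then show ?thesis
        unfolding t by (auto simp: Cons_image canonicals_def)
    qed
  next
    case False
    then have "length t \<noteq> Suc (Suc N)"
      by (auto simp: length_Suc_conv)
    then show ?thesis
      by (auto simp: canonicals_def)
  qed
qed

lemma card_canonicals_Suc:
  "int (card (canonicals (Suc N) m h)) = int (card (canonicals (Suc N) m (Suc h)))
    + (if h = 0 then 0
       else int (card (canonicals N m (h - 1))) - int (card (canonicals N m h)))
    + (if m = 0 then 0 else int (card (canonicals N (m - 1) h)))"
proof -
  have diff: "int (card (canonicals N' m' h' - canonicals N' m' (Suc h'))) =
      int (card (canonicals N' m' h')) - int (card (canonicals N' m' (Suc h')))" for N' m' h'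
    using canonicals_antimono[of N' m' h']
    by (simp add: card_Diff_subset card_mono of_nat_diff)
  let ?U = "if h = 0 then {} else (#) h ` (canonicals N m (h - 1) - canonicals N m h)"
  let ?W = "if m = 0 then {} else (#) h ` canonicals N (m - 1) h"
  have "?U \<inter> ?W = {}"
    by (auto simp: canonicals_def)
  moreover have "finite ?U" "finite ?W"
    by auto
  ultimately have "card (?U \<union> ?W) = card ?U + card ?W"
    by (intro card_Un_disjoint)
  moreover have "int (card ?U) = (if h = 0 then 0
      else int (card (canonicals N m (h - 1))) - int (card (canonicals N m h)))"
    using diff[of N m "h - 1"] by (cases h) (simp_all add: card_image)
  moreover have "int (card ?W) = (if m = 0 then 0 else int (card (canonicals N (m - 1) h)))"
    by (simp add: card_image)
  ultimately show ?thesis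
    using diff[of "Suc N" m h] unfolding canonicals_diff_Suc by linarith
qed

text \<open>Here \<open>k\<close> stands for \<open>N - h\<close>. The case \<open>m = 0\<close> is
  separate because the subtracted product is absent there.\<close>

fun reflection_count :: "nat \<Rightarrow> nat \<Rightarrow> nat \<Rightarrow> int" where
  "reflection_count N 0 k = 1"
| "reflection_count N (Suc m) k =
    int (N choose Suc m) * int (k choose Suc m) - int (N choose m) * int (k choose Suc (Suc m))"

text \<open>Pascal's rule yields the recursion of \<open>card_canonicals_Suc\<close>, rewritten in
  \<open>k = N - h\<close>.\<close>

lemma reflection_count_Suc:
  "reflection_count (Suc N) m (Suc k) = reflection_count (Suc N) m k
    + reflection_count N m (Suc k) - reflection_count N m k
    + (if m = 0 then 0 else reflection_count N (m - 1) k)"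
proof (cases m)
  case (Suc l)
  then show ?thesis
    by (cases l) (simp_all add: algebra_simps)
qed simp

text \<open>For \<open>h = 0\<close> the recursion for the cardinalities lacks the difference of two
  terms; this equality makes that difference vanish in the formula too.\<close>

lemma reflection_count_boundary: "reflection_count N m (Suc N) = reflection_count N m N"
  by (cases m) (simp_all add: algebra_simps)

lemma card_canonicals:
  "k \<le> N \<Longrightarrow> int (card (canonicals N m (N - k))) = reflection_count N m k"
proof (induction N arbitrary: m k)
  case 0
  have "canonicals 0 m 0 = (if m = 0 then {[0]} else {})"
    by (auto simp: canonicals_def length_Suc_conv)
  then show ?case
    using 0 by (cases m) auto
next
  case (Suc N)
  note outer = Suc.IH
  \<comment> \<open>The inner induction lowers the bound \<open>h = Suc N - k\<close> from
    \<open>Suc N\<close>, above which no first entry is possible.\<close>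
  show ?case
    using Suc.prems
  proof (induction k)
    case 0
    show ?case
      using card_canonicals_Suc[of N m "Suc N"] outer[of 0 m]
      by (cases m) (simp_all add: canonicals_empty)
  next
    case (Suc k)
    then have k: "k \<le> N" "Suc N - k = Suc (N - k)"
      by auto
    show ?case
    proof (cases "k = N")
      case True
      then show ?thesis
        using card_canonicals_Suc[of N m "N - k"] Suc k outer[of k]
          reflection_count_Suc[of N m k] reflection_count_boundary[of N m]
        by simp
    next
      case False
      then have "Suc k \<le> N" "N - k - 1 = N - Suc k"
        using k by auto
      then show ?thesis
        using card_canonicals_Suc[of N m "N - k"] Suc k reflection_count_Suc[of N m k] False outer[of k] outer[of "Suc k"]
        by simp
    qed
  qed
qed

text \<open>With \<open>m = n - r\<close>, symmetry turns the two binomials of the Narayana number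
  into \<open>n choose m\<close> and \<open>n choose Suc m\<close>; the rest is absorption.\<close>

lemma reflection_count_narayana:
  assumes "1 \<le> r" "r \<le> n"
  shows "real_of_int (reflection_count (n - 1) (n - r) (n - 1)) = narayana n r"
proof -
  obtain N where n: "n = Suc N"
    using assms by (cases n) auto
  have sym: "n choose r = Suc N choose (n - r)" "n choose (r - 1) = Suc N choose Suc (n - r)"
    using binomial_symmetric[of r n] binomial_symmetric[of "r - 1" n] assms n
    by (simp_all add: Suc_diff_le del: binomial_Suc_Suc)
  have "real (Suc N) * reflection_count N m N = real (Suc N choose m) * real (Suc N choose Suc m)"
    for m
  proof (cases m)
    case (Suc l)
    have absorb: "real (Suc N) * real (N choose k) = real (Suc N choose Suc k) * real (Suc k)" for k
      by (metis Suc_times_binomial_eq of_nat_mult)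
    let ?a = "real (N choose l)" and ?b = "real (N choose Suc l)"
      and ?c = "real (N choose Suc (Suc l))"
    have ab: "real (Suc N) * ?a = (?a + ?b) * real (Suc l)"
      using absorb[of l] by simp
    have bc: "real (Suc N) * ?b = (?b + ?c) * real (Suc (Suc l))"
      using absorb[of "Suc l"] by simp
    \<comment> \<open>Multiply \<open>bc\<close> by \<open>?a + ?b\<close> and \<open>ab\<close> by
      \<open>?b + ?c\<close> and subtract; the factors \<open>Suc (Suc l)\<close> and
      \<open>Suc l\<close> differ by 1.\<close>
    have "real (Suc N) * (?b * ?b - ?a * ?c) = (?a + ?b) * (?b + ?c)"
      using ab bc by (simp only: of_nat_Suc) algebra
    then show ?thesis
      using Suc by simp
  qed simp
  from this[of "n - r"] show ?thesis
    unfolding narayana_def sym using n by (simp add: field_simps)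
qed

section \<open>The lower bound\<close>

text \<open>An infinite linear order may have no infinite increasing sequence, but any
  \<open>n\<close> of its elements can be listed in order.\<close>

lemma strict_mono_on_lessThan_exists:
  assumes "infinite (UNIV :: 'a set)"
  obtains g :: "nat \<Rightarrow> 'a::linorder" where "strict_mono_on {..<n} g"
proof -
  obtain S :: "'a set" where S: "finite S" "card S = n"
    using infinite_arbitrarily_large[OF assms] by blast
  have "strict_mono_on {..<n} ((!) (sorted_list_of_set S))"
    using sorted_wrt_nth_less[OF strict_sorted_list_of_set[of S]] S
    by (intro strict_mono_onI) simp
  then show ?thesis
    by (rule that)
qed

text \<open>Pigeonhole: equal memory contents give equal answers, so canonical arrays need pairwise
  different contents.\<close>

lemma rmq_encoding_lower_bound:
  fixes preproc :: "'a::linorder list \<Rightarrow> bool list"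
  assumes inf: "infinite (UNIV :: 'a set)" and r: "1 \<le> r" "r \<le> n"
    and enc: "rmq_encoding n r s preproc query"
  shows "narayana n r \<le> 2 ^ s"
proof -
  obtain g :: "nat \<Rightarrow> 'a" where g: "strict_mono_on {..<n} g"
    using strict_mono_on_lessThan_exists[OF inf] .
  \<comment> \<open>At length \<open>n\<close>, having \<open>n - r\<close> weak ascents means
    having \<open>r\<close> runs; the bound 0 leaves the first entry free.\<close>
  let ?T = "canonicals (n - 1) (n - r) 0"
  have T: "canonical t" "length t = n" "map g t \<in> arrays_with_runs n r" if "t \<in> ?T" for t
  proof -
    show t: "canonical t" "length t = n"
      using that r by (auto simp: canonicals_def)
    have "weak_ascents (map g t) = n - r"
      using weak_ascents_map[OF g, of t] canonical_set_less[OF t(1)] t(2) that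
      by (auto simp: canonicals_def)
    then show "map g t \<in> arrays_with_runs n r"
      using card_runs[of "map g t"] t(2) r by (simp add: arrays_with_runs_def)
  qed
  have "inj_on (\<lambda>t. preproc (map g t)) ?T"
  proof (rule inj_onI)
    fix t u assume tu: "t \<in> ?T" "u \<in> ?T" and eq: "preproc (map g t) = preproc (map g u)"
    have "rmq (map g t) i j = rmq (map g u) i j" if "i \<le> j" "j < n" for i j
      using enc T(3)[OF tu(1)] T(3)[OF tu(2)] eq that unfolding rmq_encoding_def by metis
    then show "t = u"
      using canonical_eqI_rmq[of t u g] T(1,2) tu g by simp
  qed
  moreover have "(\<lambda>t. preproc (map g t)) ` ?T \<subseteq> {bs. set bs \<subseteq> UNIV \<and> length bs = s}"
    using T(3) enc by (auto simp: rmq_encoding_def)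
  moreover have "finite {bs :: bool list. set bs \<subseteq> UNIV \<and> length bs = s}"
    by (rule finite_lists_length_eq) simp
  ultimately have "card ?T \<le> card {bs :: bool list. set bs \<subseteq> UNIV \<and> length bs = s}"
    by (rule card_inj_on_le)
  also have "\<dots> = 2 ^ s"
    using card_lists_length_eq[of "UNIV :: bool set" s] by simp
  finally have "real (card ?T) \<le> 2 ^ s"
    by (metis of_nat_le_iff of_nat_numeral of_nat_power)
  moreover have "real (card ?T) = narayana n r"
    using card_canonicals[of "n - 1" "n - 1" "n - r"] reflection_count_narayana[OF r]
    by (metis diff_self_eq_0 of_int_of_nat_eq order_refl)
  ultimately show ?thesis
    by metis
qed

lemma narayana_pos:
  assumes "1 \<le> r" "r \<le> n"
  shows "0 < narayana n r"
  using assms by (simp add: narayana_def zero_less_binomial_iff)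

lemma binomial_le_mult_pred:
  assumes "1 \<le> r"
  shows "n choose r \<le> n * (n choose (r - 1))"
proof -
  have "n choose r \<le> r * (n choose r)"
    using assms by simp
  also have "\<dots> = (n - (r - 1)) * (n choose (r - 1))"
    using binomial_absorb_comp[of n "r - 1"] binomial_absorption[of "r - 1" n] assms
    by (cases r) auto
  also have "\<dots> \<le> n * (n choose (r - 1))"
    by (rule mult_right_mono) auto
  finally show ?thesis .
qed

text \<open>One \<open>log 2 (real n)\<close> is lost to the factor \<open>1 / real n\<close>, the
  other to comparing \<open>n choose (r - 1)\<close> with \<open>n choose r\<close>.\<close>

lemma log_narayana_ge:
  assumes "1 \<le> r" "r \<le> n"
  shows "2 * log 2 (real (n choose r)) - 2 * log 2 (real n) \<le> log 2 (narayana n r)"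
proof -
  have n: "0 < real n" and c: "0 < real (n choose r)"
    using assms by (auto simp: zero_less_binomial_iff)
  have "real (n choose r) \<le> real n * real (n choose (r - 1))"
    using binomial_le_mult_pred[OF assms(1), of n] by (metis of_nat_le_iff of_nat_mult)
  then have "real (n choose r) * real (n choose r)
      \<le> real (n choose r) * (real n * real (n choose (r - 1)))"
    using c by (intro mult_left_mono) auto
  then have "(real (n choose r))\<^sup>2 / (real n)\<^sup>2 \<le> narayana n r"
    using n by (simp add: narayana_def field_simps power2_eq_square)
  then have "log 2 ((real (n choose r))\<^sup>2 / (real n)\<^sup>2) \<le> log 2 (narayana n r)"
    using n c by (intro log_mono) auto
  then show ?thesis
    using n c by (simp add: log_divide log_nat_power)
qed

theorem mainTheorem4:
  shows "(\<forall>n r s (preproc :: 'a::linorder list \<Rightarrow> bool list) query.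
            infinite (UNIV :: 'a set) \<and> 1 \<le> r \<and> r \<le> n \<and> rmq_encoding n r s preproc query
            \<longrightarrow> real s \<ge> log 2 (narayana n r)) \<and>
         (\<exists>err \<in> O(\<lambda>n. log 2 (real n)). \<forall>n r. 1 \<le> r \<and> r \<le> n
            \<longrightarrow> log 2 (narayana n r) \<ge> 2 * log 2 (real (n choose r)) - err n)"
proof (intro conjI allI impI)
  fix n r s and preproc :: "'a list \<Rightarrow> bool list" and query
  assume "infinite (UNIV :: 'a set) \<and> 1 \<le> r \<and> r \<le> n \<and> rmq_encoding n r s preproc query"
  then have "narayana n r \<le> 2 ^ s" "0 < narayana n r"
    using rmq_encoding_lower_bound narayana_pos by blast+
  then have "log 2 (narayana n r) \<le> log 2 (2 ^ s)"
    by (intro log_mono) auto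
  then show "log 2 (narayana n r) \<le> real s"
    by simp
next
  show "\<exists>err \<in> O(\<lambda>n. log 2 (real n)). \<forall>n r. 1 \<le> r \<and> r \<le> n
      \<longrightarrow> log 2 (narayana n r) \<ge> 2 * log 2 (real (n choose r)) - err n"
    using log_narayana_ge by (intro bexI[of _ "\<lambda>n. 2 * log 2 (real n)"]) auto
qed

end
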